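(* Let $(P,\preceq)$ be a locally finite lattice and let $f:P\to\mathbb{C}$ be semimultiplicative with $f(x)\neq0$ for all $x\in P$. Let $S=\{x_1,\dots,x_n\}\subseteq P$ be join-closed, indexed so that $x_i\preceq x_j\Rightarrow i\le j$. Then $$\det(S)_f=\prod_{v=1}^n f(x_v)^2\Psi_{S,1/f}(x_v)=\prod_{v=1}^n f(x_v)^2\sum_{x_u\in S,\ x_v\preceq x_u}\frac{\mu_S(x_v,x_u)}{f(x_u)}=\prod_{v=1}^n f(x_v)^2\sum_{\substack{z\in P_S,\ x_v\preceq z\\ x_t\not\preceq z\ \text{for all } t>v}}\ \sum_{z\preceq w\preceq\vee S}\frac{\mu(z,w)}{f(w)}.$$
   Context: $f$ is semimultiplicative if $f(x)f(y)=f(x\wedge y)f(x\vee y)$ for all $x,y\in P$. $S$ is join-closed if $x\vee y\in S$ for all $x,y\in S$. $(S)_f$ is the $n\times n$ matrix with $(i,j)$ entry $f(x_i\wedge x_j)$. $\Psi_{S,1/f}$ is defined on $S$ recursively by $\Psi_{S,1/f}(x_k)=1/f(x_k)-\sum_{x_v\in S,\ x_k\prec x_v}\Psi_{S,1/f}(x_v)$. $\mu_S$ is the Möbius function of $(S,\preceq)$. $\vee S=x_1\vee\cdots\vee x_n$, $P_S=\{y\in P:y\preceq\vee S\text{ and }x_i\preceq y\text{ for some }x_i\in S\}$, and $\mu$ is the Möbius function of $(P,\preceq)$ (which agrees with that of $(P_S,\preceq)$ on pairs in $P_S$). *)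

theory Defs
  imports Complex_Main "Jordan_Normal_Form.Determinant"
begin

definition locally_finite :: "'a::order itself \<Rightarrow> bool" where
  "locally_finite _ \<longleftrightarrow> (\<forall>x y :: 'a. finite {x..y})"

definition semimultiplicative :: "('a::lattice \<Rightarrow> complex) \<Rightarrow> bool" where
  "semimultiplicative f \<longleftrightarrow> (\<forall>x y. f x * f y = f (inf x y) * f (sup x y))"

definition join_closed :: "'a::semilattice_sup set \<Rightarrow> bool" where
  "join_closed S \<longleftrightarrow> (\<forall>x\<in>S. \<forall>y\<in>S. sup x y \<in> S)"

definition meet_matrix :: "nat \<Rightarrow> (nat \<Rightarrow> 'a::semilattice_inf) \<Rightarrow> ('a \<Rightarrow> complex) \<Rightarrow> complex mat" where
  "meet_matrix n x f = mat n n (\<lambda>(i, j). f (inf (x i) (x j)))"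

text \<open>
  The function \<open>\<Psi>\<^bsub>S,g\<^esub>\<close> for finite \<open>S\<close>, determined by
  \<open>\<Psi>\<^bsub>S,g\<^esub>(x) = g x - (\<Sum>v \<in> S, x < v. \<Psi>\<^bsub>S,g\<^esub>(v))\<close> on \<open>S\<close>.  The guard only makes the
  recursion total: outside \<open>S\<close>, or for infinite \<open>S\<close>, the value is \<open>0\<close> by convention.
\<close>

function Psi :: "'a::order set \<Rightarrow> ('a \<Rightarrow> complex) \<Rightarrow> 'a \<Rightarrow> complex" where
  "Psi S g x = (if finite S \<and> x \<in> S then g x - (\<Sum>v\<in>{v \<in> S. x < v}. Psi S g v) else 0)"
  by pat_completeness auto
termination
proof (relation "measure (\<lambda>(S, g, x). card {v \<in> S. x < v})", goal_cases)
  case 1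
  show ?case by simp
next
  case (2 S g x v)
  then have "{u \<in> S. v < u} \<subset> {u \<in> S. x < u}"
    by (auto dest: less_trans)
  with 2 show ?case
    by (simp add: psubset_card_mono)
qed

declare Psi.simps [simp del]

text \<open>
  The Moebius function of the poset \<open>(S, \<le>)\<close>, given by \<open>\<mu>(x,x) = 1\<close>,
  \<open>\<mu>(x,y) = - (\<Sum>z \<in> S, x \<le> z < y. \<mu>(x,z))\<close> for \<open>x < y\<close>, and \<open>\<mu>(x,y) = 0\<close> otherwise.
  The guard on finiteness of the interval makes the recursion total and is void when \<open>(S, \<le>)\<close>
  is locally finite.
\<close>

function moebius :: "'a::order set \<Rightarrow> 'a \<Rightarrow> 'a \<Rightarrow> int" where
  "moebius S x y =
     (if x \<in> S \<and> y \<in> S \<and> x \<le> y \<and> finite {z \<in> S. x \<le> z \<and> z \<le> y}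
      then if x = y then 1 else - (\<Sum>z\<in>{z \<in> S. x \<le> z \<and> z < y}. moebius S x z)
      else 0)"
  by pat_completeness auto
termination
proof (relation "measure (\<lambda>(S, x, y). card {z \<in> S. x \<le> z \<and> z \<le> y})", goal_cases)
  case 1
  show ?case by simp
next
  case (2 S x y z)
  then have "{u \<in> S. x \<le> u \<and> u \<le> z} \<subset> {u \<in> S. x \<le> u \<and> u \<le> y}"
    by (auto intro: order.trans dest: less_le_not_le[THEN iffD1])
  with 2 show ?case
    by (simp add: psubset_card_mono)
qed

declare moebius.simps [simp del]

definition P_sub :: "'a::lattice set \<Rightarrow> 'a set" where
  "P_sub S = {y. y \<le> Sup_fin S \<and> (\<exists>x\<in>S. x \<le> y)}"

end

theory Submission
  imports Defs
begin

text \<open>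
  Semimultiplicativity turns the entries into
  \<open>f (inf a b) = f a * f b * g (sup a b)\<close> with \<open>g = 1 / f\<close>. Since \<open>S\<close> is join-closed,
  \<open>g (sup a b)\<close> is the sum of \<open>\<Psi>\<^bsub>S,g\<^esub>(u)\<close> over the common upper bounds \<open>u \<in> S\<close> of \<open>a\<close> and \<open>b\<close>,
  which factors the matrix into an upper and a lower triangular one. Moebius inversion gives the
  second product. For the third, each \<open>z \<in> P\<^bsub>S\<^esub>\<close> lies above a greatest element of
  the join-closed set \<open>S\<close>, which is the one with the largest index; grouping the
  \<open>z\<close> by that element sums \<open>\<Psi>\<close> of \<open>P\<^bsub>S\<^esub>\<close> to \<open>\<Psi>\<close> of \<open>S\<close>.
\<close>

section \<open>\<open>Psi\<close> and Moebius inversion\<close>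

lemma sum_Psi_above:
  assumes "finite S" "x \<in> S"
  shows "(\<Sum>u\<in>{u \<in> S. x \<le> u}. Psi S g u) = g x"
proof -
  have "{u \<in> S. x \<le> u} = insert x {u \<in> S. x < u}"
    using assms by auto
  then show ?thesis
    using assms by (simp add: Psi.simps[of S g x])
qed

text \<open>Summing over the elements above \<open>x\<close> isolates \<open>h x\<close> once the
  values strictly above are known, so induction on their number applies. It serves to recognise
  block sums as values of \<open>Psi\<close>.\<close>

lemma Psi_unique:
  assumes fin: "finite S" and h: "\<And>x. x \<in> S \<Longrightarrow> (\<Sum>u\<in>{u \<in> S. x \<le> u}. h u) = g x"
    and "x \<in> S"
  shows "Psi S g x = h x"
  using \<open>x \<in> S\<close>
proof (induction "card {u \<in> S. x < u}" arbitrary: x rule: less_induct)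
  case less
  have "Psi S g v = h v" if v: "v \<in> {u \<in> S. x < u}" for v
  proof -
    have "{u \<in> S. v < u} \<subset> {u \<in> S. x < u}"
      using v by (auto dest: less_trans)
    then have "card {u \<in> S. v < u} < card {u \<in> S. x < u}"
      using fin by (simp add: psubset_card_mono)
    then show ?thesis
      using less.hyps v by simp
  qed
  moreover have "{u \<in> S. x \<le> u} = insert x {u \<in> S. x < u}"
    using less.prems by auto
  then have "h x + (\<Sum>u\<in>{u \<in> S. x < u}. h u) = g x"
    using h[OF less.prems] fin by simp
  ultimately show ?case
    using less.prems fin by (simp add: Psi.simps[of S g x] algebra_simps)
qed

lemma sum_moebius_interval:
  assumes "x \<in> U" "y \<in> U" "x \<le> y" "finite {z \<in> U. x \<le> z \<and> z \<le> y}"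
  shows "(\<Sum>z\<in>{z \<in> U. x \<le> z \<and> z \<le> y}. moebius U x z) = (if x = y then 1 else 0)"
proof (cases "x = y")
  case True
  then have "{z \<in> U. x \<le> z \<and> z \<le> y} = {x}"
    using assms by auto
  then show ?thesis
    using True assms by (simp add: moebius.simps[of U y y])
next
  case False
  have eq: "{z \<in> U. x \<le> z \<and> z \<le> y} = insert y {z \<in> U. x \<le> z \<and> z < y}"
    using assms by auto
  then have "finite {z \<in> U. x \<le> z \<and> z < y}"
    using assms(4) by simp
  then show ?thesis
    using False assms by (simp add: eq moebius.simps[of U x y])
qed

text \<open>Only the intervals of \<open>T\<close> matter, so the Moebius function may be taken in any poset
  \<open>U\<close> in which \<open>T\<close> is convex; the theorem needs \<open>U = T\<close> and \<open>U = UNIV\<close>.\<close>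

lemma Psi_eq_sum_moebius:
  assumes fin: "finite T" and "T \<subseteq> U" and "x \<in> T"
    and convex: "\<And>y u. y \<in> T \<Longrightarrow> u \<in> U \<Longrightarrow> x \<le> u \<Longrightarrow> u \<le> y \<Longrightarrow> u \<in> T"
  shows "Psi T g x = (\<Sum>y\<in>{y \<in> T. x \<le> y}. of_int (moebius U x y) * g y)"
proof -
  let ?A = "{y \<in> T. x \<le> y}"
  \<comment> \<open>Expand each \<open>g y\<close> into \<open>Psi\<close> values above
    \<open>y\<close> and exchange the sums: the coefficient of \<open>Psi T g u\<close> becomes a
    full Moebius sum over the interval from \<open>x\<close> to \<open>u\<close>.\<close>
  have "(\<Sum>y\<in>?A. of_int (moebius U x y) * g y) =
      (\<Sum>y\<in>?A. \<Sum>u\<in>{u \<in> ?A. y \<le> u}. of_int (moebius U x y) * Psi T g u)"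
  proof (rule sum.cong)
    fix y assume y: "y \<in> ?A"
    then have "{u \<in> ?A. y \<le> u} = {u \<in> T. y \<le> u}"
      by auto
    then show "of_int (moebius U x y) * g y =
        (\<Sum>u\<in>{u \<in> ?A. y \<le> u}. of_int (moebius U x y) * Psi T g u)"
      using y sum_Psi_above[OF fin, of y g] by (simp flip: sum_distrib_left)
  qed simp
  also have "\<dots> = (\<Sum>u\<in>?A. \<Sum>y\<in>{y \<in> ?A. y \<le> u}. of_int (moebius U x y) * Psi T g u)"
    using fin by (intro sum.swap_restrict) auto
  also have "\<dots> = (\<Sum>u\<in>?A. if u = x then Psi T g x else 0)"
  proof (rule sum.cong)
    fix u assume u: "u \<in> ?A"
    \<comment> \<open>Convexity: no element of \<open>U\<close> between \<open>x\<close> and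
      \<open>u\<close> lies outside \<open>T\<close>.\<close>
    have eq: "{y \<in> ?A. y \<le> u} = {y \<in> U. x \<le> y \<and> y \<le> u}"
      using convex u \<open>T \<subseteq> U\<close> by auto
    have "finite {y \<in> ?A. y \<le> u}"
      using fin by simp
    then have "(\<Sum>y\<in>{y \<in> ?A. y \<le> u}. moebius U x y) = (if x = u then 1 else 0)"
      unfolding eq using u \<open>T \<subseteq> U\<close> \<open>x \<in> T\<close> by (intro sum_moebius_interval) auto
    then show "(\<Sum>y\<in>{y \<in> ?A. y \<le> u}. of_int (moebius U x y) * Psi T g u) =
        (if u = x then Psi T g x else 0)"
      by (auto simp flip: sum_distrib_right of_int_sum)
  qed simp
  also have "\<dots> = Psi T g x"
    using fin \<open>x \<in> T\<close> by simp
  finally show ?thesis by simp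
qed

section \<open>Factorization of the meet matrix\<close>

lemma det_meet_matrix_join_closed:
  fixes f :: "'a::lattice \<Rightarrow> complex"
  assumes semi: "semimultiplicative f"
    and nz: "\<And>y. f y \<noteq> 0"
    and bij: "bij_betw x {..<n} S"
    and join: "join_closed S"
    and ord: "\<And>i j. i < n \<Longrightarrow> j < n \<Longrightarrow> x i \<le> x j \<Longrightarrow> i \<le> j"
  shows "det (meet_matrix n x f) = (\<Prod>v<n. (f (x v))\<^sup>2 * Psi S (\<lambda>y. 1 / f y) (x v))"
proof -
  define \<psi> where "\<psi> = Psi S (\<lambda>y. 1 / f y)"
  define A where "A = mat n n (\<lambda>(i, k). if x i \<le> x k then f (x i) else 0)"
  define B where "B = mat n n (\<lambda>(k, j). if x j \<le> x k then \<psi> (x k) * f (x j) else 0)"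
  have A: "A \<in> carrier_mat n n" and B: "B \<in> carrier_mat n n"
    by (auto simp: A_def B_def)
  have fin: "finite S"
    using bij bij_betw_finite by blast
  have in_S: "x i \<in> S" if "i < n" for i
    using bij that by (auto simp: bij_betw_def)
  have entry: "f (inf (x i) (x j)) =
      (\<Sum>k<n. (if x i \<le> x k then f (x i) else 0) * (if x j \<le> x k then \<psi> (x k) * f (x j) else 0))"
    if "i < n" "j < n" for i j
  proof -
    let ?s = "sup (x i) (x j)"
    have "?s \<in> S"
      using join in_S that by (simp add: join_closed_def)
    then have "1 / f ?s = (\<Sum>u\<in>{u \<in> S. ?s \<le> u}. \<psi> u)"
      unfolding \<psi>_def by (rule sum_Psi_above[OF fin, symmetric])
    also have "\<dots> = (\<Sum>u\<in>S. if ?s \<le> u then \<psi> u else 0)"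
      using fin by (simp add: sum.inter_filter)
    also have "\<dots> = (\<Sum>k<n. if ?s \<le> x k then \<psi> (x k) else 0)"
      by (rule sum.reindex_bij_betw[OF bij, symmetric])
    \<comment> \<open>The condition \<open>?s \<le> x k\<close> means \<open>x i \<le> x k\<close>
      and \<open>x j \<le> x k\<close>, so each summand splits into an entry of \<open>A\<close>
      times an entry of \<open>B\<close>.\<close>
    finally have "f (x i) * f (x j) * (1 / f ?s) =
        (\<Sum>k<n. f (x i) * f (x j) * (if ?s \<le> x k then \<psi> (x k) else 0))"
      by (simp add: sum_distrib_left)
    moreover have "f (inf (x i) (x j)) = f (x i) * f (x j) * (1 / f ?s)"
      using semi nz[of ?s] by (simp add: semimultiplicative_def field_simps)
    ultimately show ?thesis
      by (auto intro!: sum.cong)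
  qed
  \<comment> \<open>The indexing extends the order, so \<open>A\<close> vanishes below the diagonal
    and \<open>B\<close> above it.\<close>
  have not_le: "\<not> x i \<le> x j" if "j < i" "i < n" for i j
    using ord[of i j] that by auto
  have "meet_matrix n x f = A * B"
    by (rule eq_matI)
      (auto simp: meet_matrix_def A_def B_def scalar_prod_def entry atLeast0LessThan)
  moreover have "upper_triangular A"
    by (auto simp: A_def upper_triangular_def not_le)
  then have "det A = (\<Prod>v<n. f (x v))"
    by (subst det_upper_triangular[OF _ A])
      (auto simp: prod_list_diag_prod A_def atLeast0LessThan)
  moreover have "det B = (\<Prod>v<n. \<psi> (x v) * f (x v))"
    by (subst det_lower_triangular[OF _ B])
      (auto simp: prod_list_diag_prod B_def atLeast0LessThan not_le)
  ultimately show ?thesis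
    using det_mult[OF A B]
    by (simp add: \<psi>_def power2_eq_square mult_ac flip: prod.distrib)
qed

section \<open>Passing from \<open>S\<close> to \<open>P_sub S\<close>\<close>

lemma Sup_fin_in_join_closed:
  assumes "finite A" "A \<noteq> {}" "A \<subseteq> S" "join_closed S"
  shows "Sup_fin A \<in> S"
  using assms by (induction A rule: finite_ne_induct) (auto simp: join_closed_def)

lemma Psi_eq_sum_P_sub:
  fixes x :: "nat \<Rightarrow> 'a::lattice"
  assumes fin_P: "finite (P_sub S)"
    and bij: "bij_betw x {..<n} S"
    and join: "join_closed S"
    and ord: "\<And>i j. i < n \<Longrightarrow> j < n \<Longrightarrow> x i \<le> x j \<Longrightarrow> i \<le> j"
    and "v < n"
  shows "Psi S g (x v) =
    (\<Sum>z\<in>{z \<in> P_sub S. x v \<le> z \<and> (\<forall>t. v < t \<and> t < n \<longrightarrow> \<not> x t \<le> z)}. Psi (P_sub S) g z)"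
proof -
  \<comment> \<open>The elements of \<open>P_sub S\<close> whose greatest lower bound within
    \<open>S\<close> is \<open>u\<close> itself, that is, \<open>u\<close> is the greatest element
    of \<open>S\<close> below them.\<close>
  define block where
    "block u = {z \<in> P_sub S. u \<le> z \<and> (\<forall>y\<in>S. y \<le> z \<longrightarrow> y \<le> u)}" for u
  have fin: "finite S"
    using bij bij_betw_finite by blast
  have S_sub_P: "S \<subseteq> P_sub S"
    using Sup_fin.coboundedI[OF fin] by (auto simp: P_sub_def)
  have in_S: "x i \<in> S" if "i < n" for i
    using bij that by (auto simp: bij_betw_def)
  have greatest: "\<exists>u\<in>S. z \<in> block u" if z: "z \<in> P_sub S" for z
  proof -
    \<comment> \<open>The witness is the join of all elements of \<open>S\<close> below
      \<open>z\<close>. These form a nonempty join-closed set, so it contains its own join.\<close>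
    let ?B = "{y \<in> S. y \<le> z}"
    have B: "finite ?B" "?B \<noteq> {}"
      using fin z by (auto simp: P_sub_def)
    then have "Sup_fin ?B \<in> ?B"
      using join by (intro Sup_fin_in_join_closed) (auto simp: join_closed_def)
    moreover have "y \<le> Sup_fin ?B" if "y \<in> S" "y \<le> z" for y
      using B that by (intro Sup_fin.coboundedI) auto
    ultimately show ?thesis
      using z unfolding block_def by blast
  qed
  have "Psi S g a = (\<Sum>z\<in>block a. Psi (P_sub S) g z)" if "a \<in> S" for a
  proof (rule Psi_unique[OF fin _ that])
    fix b assume "b \<in> S"
    have "(\<Sum>u\<in>{u \<in> S. b \<le> u}. \<Sum>z\<in>block u. Psi (P_sub S) g z) =
        (\<Sum>z\<in>(\<Union>u\<in>{u \<in> S. b \<le> u}. block u). Psi (P_sub S) g z)"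
      using fin fin_P
      \<comment> \<open>Blocks are disjoint since a greatest element is unique.\<close>
      by (intro sum.UNION_disjoint[symmetric]) (auto simp: block_def intro: order.antisym)
    also have "(\<Union>u\<in>{u \<in> S. b \<le> u}. block u) = {z \<in> P_sub S. b \<le> z}"
    proof (intro equalityI subsetI)
      fix z assume "z \<in> {z \<in> P_sub S. b \<le> z}"
      then show "z \<in> (\<Union>u\<in>{u \<in> S. b \<le> u}. block u)"
        using greatest[of z] \<open>b \<in> S\<close> by (auto simp: block_def)
    qed (auto simp: block_def)
    also have "(\<Sum>z\<in>\<dots>. Psi (P_sub S) g z) = g b"
      using fin_P S_sub_P \<open>b \<in> S\<close> by (intro sum_Psi_above) auto
    finally show "(\<Sum>u\<in>{u \<in> S. b \<le> u}. \<Sum>z\<in>block u. Psi (P_sub S) g z) = g b" .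
  qed
  moreover have "block (x v) =
      {z \<in> P_sub S. x v \<le> z \<and> (\<forall>t. v < t \<and> t < n \<longrightarrow> \<not> x t \<le> z)}" (is "_ = ?R")
  proof (intro equalityI subsetI)
    fix z assume z: "z \<in> block (x v)"
    have "\<not> x t \<le> z" if "v < t" "t < n" for t
      using z ord[of t v] in_S[of t] that \<open>v < n\<close> by (auto simp: block_def)
    then show "z \<in> ?R"
      using z by (auto simp: block_def)
  next
    fix z assume z: "z \<in> ?R"
    then obtain u where u: "u \<in> S" "z \<in> block u"
      using greatest by auto
    then obtain i where i: "i < n" "u = x i"
      using bij by (auto simp: bij_betw_def)
    \<comment> \<open>As \<open>x i\<close> is the greatest element of \<open>S\<close> below
      \<open>z\<close>, it dominates \<open>x v\<close>, whence \<open>v \<le> i\<close>; the index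
      condition on \<open>z\<close> excludes \<open>v < i\<close>.\<close>
    have "x v \<le> x i" "x i \<le> z"
      using u i z in_S \<open>v < n\<close> by (auto simp: block_def)
    then have "i = v"
      using ord[of v i] z i \<open>v < n\<close> by (cases "v < i") auto
    then show "z \<in> block (x v)"
      using u i by simp
  qed
  ultimately show ?thesis
    using in_S[OF \<open>v < n\<close>] by simp
qed

lemma finite_P_sub:
  assumes "locally_finite TYPE('a::lattice)" "finite (S :: 'a set)"
  shows "finite (P_sub S)"
proof -
  have "P_sub S = (\<Union>x\<in>S. {x..Sup_fin S})"
    by (auto simp: P_sub_def)
  then show ?thesis
    using assms by (simp add: locally_finite_def)
qed

theorem theorem6p3:
  fixes f :: "'a::lattice \<Rightarrow> complex"
    and S :: "'a set"
    and n :: nat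
    and x :: "nat \<Rightarrow> 'a"
  assumes "locally_finite TYPE('a)"
    and "semimultiplicative f"
    and "\<And>y. f y \<noteq> 0"
    and "0 < n"
    and "bij_betw x {..<n} S"
    and "join_closed S"
    and "\<And>i j. i < n \<Longrightarrow> j < n \<Longrightarrow> x i \<le> x j \<Longrightarrow> i \<le> j"
  shows "det (meet_matrix n x f) = (\<Prod>v<n. (f (x v))\<^sup>2 * Psi S (\<lambda>y. 1 / f y) (x v))
       \<and> det (meet_matrix n x f) =
           (\<Prod>v<n. (f (x v))\<^sup>2 * (\<Sum>y\<in>{y \<in> S. x v \<le> y}. of_int (moebius S (x v) y) / f y))
       \<and> det (meet_matrix n x f) =
           (\<Prod>v<n. (f (x v))\<^sup>2 *
              (\<Sum>z\<in>{z \<in> P_sub S. x v \<le> z \<and> (\<forall>t. v < t \<and> t < n \<longrightarrow> \<not> x t \<le> z)}.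
                 \<Sum>w\<in>{z..Sup_fin S}. of_int (moebius UNIV z w) / f w))"
proof -
  have fin: "finite S"
    using assms(5) bij_betw_finite by blast
  note fin_P = finite_P_sub[OF assms(1) fin]
  have in_S: "x v \<in> S" if "v < n" for v
    using assms(5) that by (auto simp: bij_betw_def)
  have det: "det (meet_matrix n x f) = (\<Prod>v<n. (f (x v))\<^sup>2 * Psi S (\<lambda>y. 1 / f y) (x v))"
    by (rule det_meet_matrix_join_closed[OF assms(2,3,5-7)])
  have Psi_S: "Psi S (\<lambda>y. 1 / f y) (x v) =
      (\<Sum>y\<in>{y \<in> S. x v \<le> y}. of_int (moebius S (x v) y) / f y)" if "v < n" for v
    using Psi_eq_sum_moebius[OF fin order.refl in_S[OF that], of "\<lambda>y. 1 / f y"] by simp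
  have Psi_P: "Psi (P_sub S) (\<lambda>y. 1 / f y) z =
      (\<Sum>w\<in>{z..Sup_fin S}. of_int (moebius UNIV z w) / f w)" if z: "z \<in> P_sub S" for z
  proof -
    \<comment> \<open>Anything above \<open>z\<close> is also above an element of \<open>S\<close>,
      so only the bound by \<open>Sup_fin S\<close> remains. The same fact makes
      \<open>P_sub S\<close> convex, which permits the Moebius function of the whole
      lattice.\<close>
    have "{w \<in> P_sub S. z \<le> w} = {z..Sup_fin S}"
      using z order.trans unfolding P_sub_def by auto blast
    moreover have "Psi (P_sub S) (\<lambda>y. 1 / f y) z =
        (\<Sum>w\<in>{w \<in> P_sub S. z \<le> w}. of_int (moebius UNIV z w) * (1 / f w))"
      using fin_P z
      by (intro Psi_eq_sum_moebius) (auto simp: P_sub_def intro: order.trans)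
    ultimately show ?thesis
      by simp
  qed
  have "det (meet_matrix n x f) =
      (\<Prod>v<n. (f (x v))\<^sup>2 *
        (\<Sum>z\<in>{z \<in> P_sub S. x v \<le> z \<and> (\<forall>t. v < t \<and> t < n \<longrightarrow> \<not> x t \<le> z)}.
           \<Sum>w\<in>{z..Sup_fin S}. of_int (moebius UNIV z w) / f w))"
    unfolding det
    by (intro prod.cong)
      (auto simp: Psi_eq_sum_P_sub[OF fin_P assms(5-7)] Psi_P intro!: sum.cong)
  moreover have "det (meet_matrix n x f) =
      (\<Prod>v<n. (f (x v))\<^sup>2 * (\<Sum>y\<in>{y \<in> S. x v \<le> y}. of_int (moebius S (x v) y) / f y))"
    unfolding det by (intro prod.cong) (auto simp: Psi_S)
  ultimately show ?thesis
    using det by blast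
qed

end
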